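(* Let $\mu$ and $\nu$ be partitions of $n$. Then $\mu$ and $\nu$ are rook equivalent if and only if $\mu$ and $\nu$ are $(i,1)$-equivalent.
   Context: Partitions are identified with Ferrers boards; box $(i,j)$ is in row $i$ from the top and column $j$ from the left. Two partitions are rook equivalent if for every $k\ge0$ they have the same number of placements of $k$ non-attacking rooks (no two in the same row or column) on their Ferrers boards. For a box $(i,j)$ of $\mu$, if replacing the subboard $\{(x,y)\in\mu:x\ge i,\ y\ge j\}$ by its conjugate (transpose, anchored at box $(i,j)$) yields a partition, this partition is the $(i,j)$-transform of $\mu$. Two partitions are $(i,1)$-equivalent if one can be obtained from the other by a sequence of $(i,1)$-transformations (with $i$ allowed to vary). *)

theory Defs
  imports Main
begin

definition is_partition :: "nat list \<Rightarrow> bool" where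
  "is_partition \<mu> \<longleftrightarrow> sorted_wrt (\<ge>) \<mu> \<and> 0 \<notin> set \<mu>"

definition is_partition_of :: "nat \<Rightarrow> nat list \<Rightarrow> bool" where
  "is_partition_of n \<mu> \<longleftrightarrow> is_partition \<mu> \<and> sum_list \<mu> = n"

(* Boxes are 1-indexed pairs (row from the top, column from the left);
   list positions are 0-indexed, so row i has length \<mu> ! (i - 1). *)
definition ferrers :: "nat list \<Rightarrow> (nat \<times> nat) set" where
  "ferrers \<mu> = {(i, j). 1 \<le> i \<and> i \<le> length \<mu> \<and> 1 \<le> j \<and> j \<le> \<mu> ! (i - 1)}"

definition rook_placements :: "nat \<Rightarrow> (nat \<times> nat) set \<Rightarrow> (nat \<times> nat) set set" where
  "rook_placements k B =
     {P. P \<subseteq> B \<and> finite P \<and> card P = k \<and>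
         (\<forall>p\<in>P. \<forall>q\<in>P. p \<noteq> q \<longrightarrow> fst p \<noteq> fst q \<and> snd p \<noteq> snd q)}"

definition rook_equivalent :: "nat list \<Rightarrow> nat list \<Rightarrow> bool" where
  "rook_equivalent \<mu> \<nu> \<longleftrightarrow>
     (\<forall>k. card (rook_placements k (ferrers \<mu>)) = card (rook_placements k (ferrers \<nu>)))"

(* The boxes weakly below and to the right of (i, j) are reflected in the diagonal
   through (i, j), i.e. (i + a, j + b) goes to (i + b, j + a); all others stay.
   The result need not be the board of a partition. *)
definition board_transform :: "nat \<Rightarrow> nat \<Rightarrow> (nat \<times> nat) set \<Rightarrow> (nat \<times> nat) set" where
  "board_transform i j B =
     {(x, y). (x, y) \<in> B \<and> \<not> (i \<le> x \<and> j \<le> y)} \<union>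
     {(i + b, j + a) | a b. (i + a, j + b) \<in> B}"

definition is_transform :: "nat \<Rightarrow> nat \<Rightarrow> nat list \<Rightarrow> nat list \<Rightarrow> bool" where
  "is_transform i j \<mu> \<nu> \<longleftrightarrow>
     (i, j) \<in> ferrers \<mu> \<and> is_partition \<nu> \<and> ferrers \<nu> = board_transform i j (ferrers \<mu>)"

definition i1_step :: "nat list \<Rightarrow> nat list \<Rightarrow> bool" where
  "i1_step \<mu> \<nu> \<longleftrightarrow> (\<exists>i. is_transform i 1 \<mu> \<nu>)"

definition i1_equivalent :: "nat list \<Rightarrow> nat list \<Rightarrow> bool" where
  "i1_equivalent \<mu> \<nu> \<longleftrightarrow> i1_step\<^sup>*\<^sup>* \<mu> \<nu> \<or> i1_step\<^sup>*\<^sup>* \<nu> \<mu>"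

end

theory Submission
  imports Defs "HOL-Library.List_Lexorder" "HOL-Computational_Algebra.Polynomial"
begin

text \<open>
  Adding a top row of length \<open>m\<close> at least as long as all rows of \<open>\<lambda>\<close> changes the rook numbers by
  \<open>r(k+1) \<mapsto> r(k+1) + (m - k) r(k)\<close>, so the rook numbers of \<open>u @ \<lambda>\<close> depend only on \<open>u\<close> and on the
  rook numbers of \<open>\<lambda>\<close>, which conjugation preserves. Conversely, a partition that is lexicographically
  maximal among those reachable from it by \<open>(i,1)\<close>-transformations has distinct parts, and a
  partition with distinct parts is determined by its rook numbers because the recurrence factors the
  polynomial \<open>\<Sum>k. r(k) x(x-1)\<dots>(x-l+k+1)\<close> into linear factors (Goldman, Joichi and White) that
  occur in sorted order when the parts are distinct.
\<close>

section \<open>Rook numbers\<close>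

definition rook_number :: "nat \<Rightarrow> (nat \<times> nat) set \<Rightarrow> nat" where
  "rook_number k B = card (rook_placements k B)"

lemma rook_equivalent_iff:
  "rook_equivalent \<mu> \<nu> \<longleftrightarrow> (\<forall>k. rook_number k (ferrers \<mu>) = rook_number k (ferrers \<nu>))"
  by (simp add: rook_equivalent_def rook_number_def)

lemma rook_number_0 [simp]: "rook_number 0 B = 1"
proof -
  have "rook_placements 0 B = {{}}"
    by (auto simp: rook_placements_def)
  then show ?thesis by (simp add: rook_number_def)
qed

lemma rook_number_empty_Suc [simp]: "rook_number (Suc k) {} = 0"
proof -
  have "rook_placements (Suc k) {} = {}"
    by (auto simp: rook_placements_def)
  then show ?thesis by (simp add: rook_number_def)
qed

text \<open>Since \<open>h\<close> preserves and reflects non-attack, taking images is a bijection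
  of placements. The condition treats both coordinates together, so transposition qualifies as well
  as a shift of rows.\<close>

lemma rook_number_image:
  assumes inj: "inj_on h B"
    and att: "\<And>p q. p \<in> B \<Longrightarrow> q \<in> B \<Longrightarrow>
      (fst (h p) \<noteq> fst (h q) \<and> snd (h p) \<noteq> snd (h q)) \<longleftrightarrow> (fst p \<noteq> fst q \<and> snd p \<noteq> snd q)"
  shows "rook_number k (h ` B) = rook_number k B"
proof -
  have "rook_placements k (h ` B) = (`) h ` rook_placements k B"
  proof (intro set_eqI iffI)
    fix Q assume Q: "Q \<in> rook_placements k (h ` B)"
    then have "Q \<subseteq> h ` B" by (simp add: rook_placements_def)
    then obtain P where P: "P \<subseteq> B" "Q = h ` P"
      by (auto simp: subset_image_iff)
    have injP: "inj_on h P" using inj P(1) by (rule inj_on_subset)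
    have "P \<in> rook_placements k B"
      unfolding rook_placements_def
    proof (intro CollectI conjI ballI impI)
      show "finite P" using Q P injP by (auto simp: rook_placements_def finite_image_iff)
      show "card P = k" using Q P injP by (auto simp: rook_placements_def card_image)
      fix p q assume pq: "p \<in> P" "q \<in> P" "p \<noteq> q"
      then have "h p \<noteq> h q" using injP by (auto simp: inj_on_def)
      then have "fst (h p) \<noteq> fst (h q) \<and> snd (h p) \<noteq> snd (h q)"
        using Q P pq by (auto simp: rook_placements_def)
      then have "fst p \<noteq> fst q \<and> snd p \<noteq> snd q"
        using att[of p q] P pq by blast
      then show "fst p \<noteq> fst q" "snd p \<noteq> snd q" by auto
    qed (fact P)
    then show "Q \<in> (`) h ` rook_placements k B" using P by blast
  next
    fix Q assume "Q \<in> (`) h ` rook_placements k B"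
    then obtain P where P: "P \<in> rook_placements k B" "Q = h ` P" by blast
    then have PB: "P \<subseteq> B" by (simp add: rook_placements_def)
    have injP: "inj_on h P" using inj PB by (rule inj_on_subset)
    have non: "fst (h p) \<noteq> fst (h q) \<and> snd (h p) \<noteq> snd (h q)"
      if "p \<in> P" "q \<in> P" "h p \<noteq> h q" for p q
    proof -
      have "fst p \<noteq> fst q \<and> snd p \<noteq> snd q"
        using that P by (auto simp: rook_placements_def)
      then show ?thesis using att[of p q] that PB by blast
    qed
    show "Q \<in> rook_placements k (h ` B)"
      unfolding rook_placements_def P(2)
      using P(1) PB injP non by (auto simp: rook_placements_def card_image)
  qed
  moreover have "inj_on ((`) h) (rook_placements k B)"
    by (intro inj_on_image inj_on_subset[OF inj]) (auto simp: rook_placements_def)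
  ultimately show ?thesis by (simp add: rook_number_def card_image)
qed

lemma finite_rook_placements: "finite B \<Longrightarrow> finite (rook_placements k B)"
  by (rule finite_subset[of _ "Pow B"]) (auto simp: rook_placements_def)

text \<open>A placement either avoids row \<open>a\<close> or adds one rook in that row to
  \<open>k\<close> rooks on \<open>B\<close>. These block exactly \<open>k\<close> cells of the row,
  as the columns of \<open>B\<close> lie in \<open>C\<close>. If \<open>k\<close> exceeds
  \<open>card C\<close>, then \<open>B\<close> has no such placement and truncated subtraction does
  no harm.\<close>

lemma rook_number_add_row:
  assumes fin: "finite B" "finite C" and a: "a \<notin> fst ` B" and C: "snd ` B \<subseteq> C"
  shows "rook_number (Suc k) ({a} \<times> C \<union> B) =
    rook_number (Suc k) B + (card C - k) * rook_number k B"
proof -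
  let ?h = "\<lambda>(P, c). insert (a, c) P"
  let ?S = "SIGMA P : rook_placements k B. C - snd ` P"
  have aP: "(a, c) \<notin> P" if "P \<in> rook_placements k' B" for P c k'
    using that a by (force simp: rook_placements_def)
  have h_in: "insert (a, c) P \<in> rook_placements (Suc k) ({a} \<times> C \<union> B)"
    if P: "P \<in> rook_placements k B" and c: "c \<in> C - snd ` P" for P c
  proof -
    have "fst q \<noteq> a" "snd q \<noteq> c" if "q \<in> P" for q
      using that P c a by (force simp: rook_placements_def)+
    then show ?thesis
      using P c aP[OF P, of c] by (fastforce simp: rook_placements_def)
  qed
  have split: "rook_placements (Suc k) ({a} \<times> C \<union> B) = rook_placements (Suc k) B \<union> ?h ` ?S"
  proof (intro set_eqI iffI)
    fix P assume P: "P \<in> rook_placements (Suc k) ({a} \<times> C \<union> B)"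
    show "P \<in> rook_placements (Suc k) B \<union> ?h ` ?S"
    proof (cases "\<exists>c. (a, c) \<in> P")
      case False
      then have "P \<subseteq> B" using P by (auto simp: rook_placements_def)
      then show ?thesis using P by (auto simp: rook_placements_def)
    next
      case True
      then obtain c where c: "(a, c) \<in> P" by blast
      let ?P = "P - {(a, c)}"
      have other: "fst q \<noteq> a \<and> snd q \<noteq> c" if "q \<in> ?P" for q
        using that P c unfolding rook_placements_def by fastforce
      then have "?P \<subseteq> B" using P by (fastforce simp: rook_placements_def)
      then have "?P \<in> rook_placements k B"
        using P c by (auto simp: rook_placements_def)
      moreover have "(a, c) \<in> {a} \<times> C \<union> B" using c P by (auto simp: rook_placements_def)
      then have "c \<in> C" using C by auto
      then have "c \<in> C - snd ` ?P" using other by blast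
      moreover have "P = ?h (?P, c)" using c by auto
      ultimately show ?thesis by blast
    qed
  next
    fix P assume "P \<in> rook_placements (Suc k) B \<union> ?h ` ?S"
    moreover have "rook_placements (Suc k) B \<subseteq> rook_placements (Suc k) ({a} \<times> C \<union> B)"
      by (auto simp: rook_placements_def)
    ultimately show "P \<in> rook_placements (Suc k) ({a} \<times> C \<union> B)"
      using h_in by auto
  qed
  have inj: "inj_on ?h ?S"
  proof (rule inj_onI, clarify)
    fix P c P' c'
    assume P: "P \<in> rook_placements k B" "P' \<in> rook_placements k B"
      and eq: "insert (a, c) P = insert (a, c') P'"
    have "c = c'" using eq aP[OF P(1)] aP[OF P(2)] by blast
    then show "P = P' \<and> c = c'"
      using eq insert_ident[OF aP[OF P(1), of c] aP[OF P(2), of c]] by simp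
  qed
  have choices: "card (C - snd ` P) = card C - k" if P: "P \<in> rook_placements k B" for P
  proof -
    have "inj_on snd P" using P unfolding rook_placements_def inj_on_def by blast
    then have "card (snd ` P) = k" using P by (simp add: rook_placements_def card_image)
    moreover have "snd ` P \<subseteq> C" using P C by (auto simp: rook_placements_def)
    ultimately show ?thesis using fin(2) by (simp add: card_Diff_subset finite_subset)
  qed
  have "card (?h ` ?S) = (\<Sum>P\<in>rook_placements k B. card (C - snd ` P))"
    using fin by (simp add: card_image[OF inj] finite_rook_placements)
  also have "\<dots> = (card C - k) * rook_number k B"
    by (simp add: choices rook_number_def)
  finally have cardh: "card (?h ` ?S) = (card C - k) * rook_number k B" .
  have "rook_placements (Suc k) B \<inter> ?h ` ?S = {}"
    using aP by auto
  then show ?thesis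
    unfolding rook_number_def[of "Suc k"] split using fin
    by (subst card_Un_disjoint) (auto simp: finite_rook_placements cardh)
qed

section \<open>Boards of partitions and conjugation\<close>

lemma is_partition_Nil [simp]: "is_partition []"
  by (simp add: is_partition_def)

lemma is_partition_Cons:
  "is_partition (m # \<mu>) \<longleftrightarrow> 0 < m \<and> (\<forall>x\<in>set \<mu>. x \<le> m) \<and> is_partition \<mu>"
  by (auto simp: is_partition_def)

lemma is_partition_append:
  "is_partition (u @ v) \<longleftrightarrow>
    is_partition u \<and> is_partition v \<and> (\<forall>x\<in>set u. \<forall>y\<in>set v. y \<le> x)"
  by (auto simp: is_partition_def sorted_wrt_append)

lemma ferrers_Nil [simp]: "ferrers [] = {}"
  by (auto simp: ferrers_def)

lemma mem_ferrers_append: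
  "(x, y) \<in> ferrers (u @ v) \<longleftrightarrow>
    (x, y) \<in> ferrers u \<or> (length u < x \<and> (x - length u, y) \<in> ferrers v)"
  by (auto simp: ferrers_def nth_append less_diff_conv2 diff_right_commute
      split: if_splits)

lemma ferrers_Cons:
  "ferrers (m # \<mu>) = {1} \<times> {1..m} \<union> map_prod Suc id ` ferrers \<mu>" (is "?L = ?R")
proof (intro set_eqI)
  fix p :: "nat \<times> nat"
  obtain x y where p: "p = (x, y)" by fastforce
  have "(x, y) \<in> map_prod Suc id ` ferrers \<mu> \<longleftrightarrow> 1 < x \<and> (x - 1, y) \<in> ferrers \<mu>"
    by (cases x) (auto simp: ferrers_def image_iff)
  then show "p \<in> ?L \<longleftrightarrow> p \<in> ?R"
    using mem_ferrers_append[of x y "[m]" \<mu>] by (auto simp: p ferrers_def)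
qed

lemma finite_ferrers [simp]: "finite (ferrers \<mu>)"
  by (induction \<mu>) (auto simp: ferrers_Cons)

text \<open>Positive parts make every row visible in the first column, so the number of rows can be
  read off the board.\<close>

lemma ferrers_inject:
  assumes "0 \<notin> set \<mu>" "0 \<notin> set \<nu>" "ferrers \<mu> = ferrers \<nu>"
  shows "\<mu> = \<nu>"
proof -
  have row: "i < length \<nu> \<and> j < \<nu> ! i \<longleftrightarrow> i < length \<mu> \<and> j < \<mu> ! i" for i j
    using assms(3)[THEN arg_cong, of "\<lambda>B. (Suc i, Suc j) \<in> B"]
    by (auto simp: ferrers_def)
  have pos: "0 < \<mu> ! i" if "i < length \<mu>" for i
    using that assms(1) nth_mem[OF that] by (metis gr0I)
  have pos': "0 < \<nu> ! i" if "i < length \<nu>" for i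
    using that assms(2) nth_mem[OF that] by (metis gr0I)
  have len: "i < length \<nu> \<longleftrightarrow> i < length \<mu>" for i
    using row[of i 0] pos[of i] pos'[of i] by blast
  then have "length \<mu> = length \<nu>"
    by (meson nat_neq_iff)
  moreover have "\<mu> ! i = \<nu> ! i" if "i < length \<mu>" for i
    using that row[of i] len[of i] by (meson nat_neq_iff)
  ultimately show ?thesis by (simp add: list_eq_iff_nth_eq)
qed

text \<open>Meaningful for nonempty lists only: \<open>hd []\<close> is unspecified.\<close>

definition conjugate :: "nat list \<Rightarrow> nat list" where
  "conjugate \<mu> = map (\<lambda>j. length (filter (\<lambda>x. j < x) \<mu>)) [0..<hd \<mu>]"

lemma length_conjugate [simp]: "length (conjugate \<mu>) = hd \<mu>"
  by (simp add: conjugate_def)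

lemma conjugate_le_length: "x \<in> set (conjugate \<mu>) \<Longrightarrow> x \<le> length \<mu>"
  by (auto simp: conjugate_def)

lemma hd_le_partition: "is_partition \<mu> \<Longrightarrow> x \<in> set \<mu> \<Longrightarrow> x \<le> hd \<mu>"
  by (cases \<mu>) (auto simp: is_partition_Cons)

lemma hd_partition_pos: "is_partition \<mu> \<Longrightarrow> \<mu> \<noteq> [] \<Longrightarrow> 0 < hd \<mu>"
  by (cases \<mu>) (auto simp: is_partition_Cons)

lemma conjugate_not_Nil: "is_partition \<mu> \<Longrightarrow> \<mu> \<noteq> [] \<Longrightarrow> conjugate \<mu> \<noteq> []"
  using hd_partition_pos[of \<mu>] by (metis length_conjugate length_greater_0_conv)

lemma hd_conjugate:
  assumes "is_partition \<mu>" "\<mu> \<noteq> []"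
  shows "hd (conjugate \<mu>) = length \<mu>"
proof -
  have "filter (\<lambda>x. 0 < x) \<mu> = \<mu>"
    using assms(1) by (auto simp: is_partition_def filter_id_conv intro: gr0I)
  then show ?thesis
    using hd_partition_pos[OF assms] by (simp add: conjugate_def hd_map)
qed

lemma is_partition_conjugate:
  assumes "is_partition \<mu>" "\<mu> \<noteq> []"
  shows "is_partition (conjugate \<mu>)"
proof -
  have "length (filter (\<lambda>x. j < x) \<mu>) \<le> length (filter (\<lambda>x. i < x) \<mu>)" if "i \<le> j" for i j
    using that by (induction \<mu>) auto
  then have "sorted_wrt (\<ge>) (conjugate \<mu>)"
    by (auto simp: conjugate_def sorted_wrt_iff_nth_less)
  moreover have "0 \<notin> set (conjugate \<mu>)"
    using assms(2) by (cases \<mu>) (auto simp: conjugate_def)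
  ultimately show ?thesis by (simp add: is_partition_def)
qed

text \<open>In a weakly decreasing list the entries above \<open>k\<close> form a prefix. This turns
  the column counts of \<open>conjugate\<close> into box membership.\<close>

lemma less_length_filter_sorted:
  assumes "sorted_wrt (\<ge>) (xs :: nat list)"
  shows "i < length (filter (\<lambda>x. k < x) xs) \<longleftrightarrow> i < length xs \<and> k < xs ! i"
  using assms
proof (induction xs arbitrary: i)
  case (Cons x xs)
  show ?case
  proof (cases "k < x")
    case True
    then show ?thesis using Cons by (cases i) auto
  next
    case False
    then have "\<forall>y\<in>set xs. \<not> k < y" using Cons.prems by auto
    then have "filter (\<lambda>x. k < x) (x # xs) = []" using False by (simp add: filter_empty_conv)
    moreover have "\<not> k < (x # xs) ! i" if "i < length (x # xs)"
      using that False \<open>\<forall>y\<in>set xs. \<not> k < y\<close> by (metis nth_mem set_ConsD)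
    ultimately show ?thesis by auto
  qed
qed simp

text \<open>This covers the empty partition too: \<open>conjugate []\<close> is a list of zeros of
  unspecified length, so its board is empty.\<close>

lemma mem_ferrers_conjugate:
  assumes "is_partition \<mu>"
  shows "(x, y) \<in> ferrers (conjugate \<mu>) \<longleftrightarrow> (y, x) \<in> ferrers \<mu>"
proof -
  have le: "\<mu> ! i \<le> hd \<mu>" if "i < length \<mu>" for i
    using hd_le_partition[OF assms] that by simp
  have "j < hd \<mu> \<and> i < length (filter (\<lambda>x. j < x) \<mu>) \<longleftrightarrow> i < length \<mu> \<and> j < \<mu> ! i" for i j
    using less_length_filter_sorted[of \<mu> i j] assms le[of i] by (auto simp: is_partition_def)
  from this[of "x - 1" "y - 1"] show ?thesis
    by (cases x; cases y) (auto simp: ferrers_def conjugate_def Suc_le_eq)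
qed

lemma ferrers_conjugate: "is_partition \<mu> \<Longrightarrow> ferrers (conjugate \<mu>) = prod.swap ` ferrers \<mu>"
  by (force simp: mem_ferrers_conjugate image_iff)

lemma conjugate_conjugate:
  assumes "is_partition \<mu>" "\<mu> \<noteq> []"
  shows "conjugate (conjugate \<mu>) = \<mu>"
proof -
  note p = is_partition_conjugate[OF assms]
  have q: "is_partition (conjugate (conjugate \<mu>))"
    using p conjugate_not_Nil[OF assms] by (rule is_partition_conjugate)
  have "ferrers (conjugate (conjugate \<mu>)) = ferrers \<mu>"
    using assms p by (auto simp: mem_ferrers_conjugate)
  then show ?thesis
    using q assms(1) by (intro ferrers_inject) (auto simp: is_partition_def)
qed

text \<open>In the case \<open>j = 1\<close> the reflected region consists of all rows from the
  \<open>i\<close>-th on, so the transform conjugates a tail of the list.\<close>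

lemma board_transform_append:
  assumes "is_partition v"
  shows "board_transform (Suc (length u)) 1 (ferrers (u @ v)) = ferrers (u @ conjugate v)"
proof -
  have "(x, y) \<in> board_transform (Suc (length u)) 1 (ferrers (u @ v)) \<longleftrightarrow>
      (x, y) \<in> ferrers (u @ conjugate v)" for x y
  proof -
    have u: "(a, b) \<in> ferrers u \<Longrightarrow> a \<le> length u" for a b
      by (simp add: ferrers_def)
    have pos: "(a, b) \<in> ferrers w \<Longrightarrow> 0 < a \<and> 0 < b" for a b w
      by (simp add: ferrers_def)
    have "(\<exists>a b. x = Suc (length u) + b \<and> y = 1 + a \<and>
          (Suc (length u) + a, 1 + b) \<in> ferrers (u @ v)) \<longleftrightarrow>
        length u < x \<and> (y, x - length u) \<in> ferrers v" (is "?E \<longleftrightarrow> ?F")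
    proof
      assume ?E
      then show ?F by (auto simp: mem_ferrers_append dest: u)
    next
      assume F: ?F
      then have "x = Suc (length u) + (x - Suc (length u))" "y = 1 + (y - 1)"
        using pos by auto
      moreover have "(Suc (length u) + (y - 1), 1 + (x - Suc (length u))) \<in> ferrers (u @ v)"
        using F pos by (auto simp: mem_ferrers_append Suc_diff_Suc)
      ultimately show ?E by blast
    qed
    moreover have "(x, y) \<in> ferrers (u @ v) \<and> \<not> (Suc (length u) \<le> x \<and> 1 \<le> y) \<longleftrightarrow>
        (x, y) \<in> ferrers u"
      using u pos by (fastforce simp: mem_ferrers_append)
    ultimately show ?thesis
      by (simp add: board_transform_def mem_ferrers_append mem_ferrers_conjugate[OF assms])
  qed
  then show ?thesis by (auto intro!: set_eqI)
qed

text \<open>List form of a step. The tail \<open>v\<close> is nonempty because the box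
  \<open>(i, 1)\<close> must lie in the board.\<close>

lemma i1_step_iff:
  assumes "is_partition \<mu>"
  shows "i1_step \<mu> \<nu> \<longleftrightarrow>
    (\<exists>u v. v \<noteq> [] \<and> \<mu> = u @ v \<and> \<nu> = u @ conjugate v \<and> is_partition \<nu>)"
proof
  assume "i1_step \<mu> \<nu>"
  then obtain i where i: "(i, 1) \<in> ferrers \<mu>" and \<nu>: "is_partition \<nu>"
    and eq: "ferrers \<nu> = board_transform i 1 (ferrers \<mu>)"
    by (auto simp: i1_step_def is_transform_def)
  define u v where "u = take (i - 1) \<mu>" and "v = drop (i - 1) \<mu>"
  have \<mu>: "\<mu> = u @ v" by (simp add: u_def v_def)
  have len: "i = Suc (length u)" and v: "v \<noteq> []"
    using i by (auto simp: u_def v_def ferrers_def)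
  have p: "is_partition u" "is_partition v"
    using assms by (auto simp: \<mu> is_partition_append)
  have "ferrers \<nu> = ferrers (u @ conjugate v)"
    using eq board_transform_append[OF p(2), of u] by (simp add: len \<mu>)
  then have "\<nu> = u @ conjugate v"
    using \<nu> p is_partition_conjugate[OF p(2) v]
    by (intro ferrers_inject) (auto simp: is_partition_def)
  then show "\<exists>u v. v \<noteq> [] \<and> \<mu> = u @ v \<and> \<nu> = u @ conjugate v \<and> is_partition \<nu>"
    using v \<mu> \<nu> by blast
next
  assume "\<exists>u v. v \<noteq> [] \<and> \<mu> = u @ v \<and> \<nu> = u @ conjugate v \<and> is_partition \<nu>"
  then obtain u v where v: "v \<noteq> []" and \<mu>: "\<mu> = u @ v" and \<nu>: "\<nu> = u @ conjugate v" "is_partition \<nu>"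
    by blast
  have p: "is_partition v" using assms by (auto simp: \<mu> is_partition_append)
  have "0 < v ! 0" using hd_partition_pos[OF p v] v by (simp add: hd_conv_nth)
  then have "(Suc (length u), 1) \<in> ferrers \<mu>"
    using v by (simp add: \<mu> ferrers_def nth_append Suc_le_eq)
  then show "i1_step \<mu> \<nu>"
    using board_transform_append[OF p, of u] \<nu>
    by (auto simp: i1_step_def is_transform_def \<mu>)
qed

lemma i1_step_is_partition: "i1_step \<mu> \<nu> \<Longrightarrow> is_partition \<nu>"
  by (auto simp: i1_step_def is_transform_def)

lemma i1_steps_is_partition: "i1_step\<^sup>*\<^sup>* \<mu> \<nu> \<Longrightarrow> is_partition \<mu> \<Longrightarrow> is_partition \<nu>"
  by (induction rule: rtranclp_induct) (auto dest: i1_step_is_partition)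

text \<open>Conjugation is an involution, so a second transformation at the same row undoes the
  first.\<close>

lemma i1_step_sym:
  assumes "i1_step \<mu> \<nu>" "is_partition \<mu>"
  shows "i1_step \<nu> \<mu>"
proof -
  have \<nu>: "is_partition \<nu>" using assms(1) by (rule i1_step_is_partition)
  obtain u v where v: "v \<noteq> []" and eq: "\<mu> = u @ v" "\<nu> = u @ conjugate v"
    using assms by (auto simp: i1_step_iff)
  have p: "is_partition v" using assms(2) by (simp add: eq is_partition_append)
  show ?thesis
    unfolding i1_step_iff[OF \<nu>]
    using conjugate_not_Nil[OF p v] conjugate_conjugate[OF p v] eq assms(2) by metis
qed

lemma i1_steps_sym: "i1_step\<^sup>*\<^sup>* \<mu> \<nu> \<Longrightarrow> is_partition \<mu> \<Longrightarrow> i1_step\<^sup>*\<^sup>* \<nu> \<mu>"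
proof (induction rule: rtranclp_induct)
  case (step \<nu> \<rho>)
  then have "i1_step \<rho> \<nu>" using i1_step_sym i1_steps_is_partition by blast
  then show ?case using step by (meson converse_rtranclp_into_rtranclp)
qed simp

text \<open>The parts of \<open>conjugate v\<close> are at most \<open>length v\<close>, so they fit
  below \<open>u\<close>.\<close>

lemma i1_step_append_conjugate:
  assumes "is_partition (u @ v)" "v \<noteq> []" "\<And>x. x \<in> set u \<Longrightarrow> length v \<le> x"
  shows "i1_step (u @ v) (u @ conjugate v)"
proof -
  have p: "is_partition u" "is_partition v"
    using assms(1) by (auto simp: is_partition_append)
  have "is_partition (u @ conjugate v)"
    using p is_partition_conjugate[OF p(2) assms(2)] assms(3)
    by (auto simp: is_partition_append dest!: conjugate_le_length intro: order_trans)
  then show ?thesis using assms(1,2) by (auto simp: i1_step_iff)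
qed

section \<open>Invariance of the rook numbers\<close>

lemma rook_number_Cons:
  assumes "is_partition (m # \<mu>)"
  shows "rook_number (Suc k) (ferrers (m # \<mu>)) =
    rook_number (Suc k) (ferrers \<mu>) + (m - k) * rook_number k (ferrers \<mu>)"
proof -
  let ?B = "map_prod Suc id ` ferrers \<mu>"
  have shift: "rook_number k ?B = rook_number k (ferrers \<mu>)" for k
    by (rule rook_number_image) (auto simp: inj_on_def)
  have "snd ` ferrers \<mu> \<subseteq> {1..m}"
  proof clarsimp
    fix x y assume "(x, y) \<in> ferrers \<mu>"
    then have "Suc 0 \<le> y \<and> y \<le> \<mu> ! (x - 1)" "x - 1 < length \<mu>"
      by (auto simp: ferrers_def)
    then show "Suc 0 \<le> y \<and> y \<le> m"
      using assms nth_mem[of "x - 1" \<mu>] by (auto simp: is_partition_Cons intro: order_trans)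
  qed
  moreover have "1 \<notin> fst ` ?B"
    by (auto simp: ferrers_def)
  ultimately have "rook_number (Suc k) ({1} \<times> {1..m} \<union> ?B) =
      rook_number (Suc k) ?B + (card {1..m} - k) * rook_number k ?B"
    by (intro rook_number_add_row) (auto simp: image_image)
  then show ?thesis by (simp add: ferrers_Cons shift)
qed

text \<open>The recurrence for a new top row involves only its length and the rook numbers of the
  rows below, so agreement propagates upwards through \<open>u\<close>.\<close>

lemma rook_number_append_cong:
  assumes "is_partition (u @ v)" "is_partition (u @ w)"
    and "\<And>k. rook_number k (ferrers v) = rook_number k (ferrers w)"
  shows "rook_number k (ferrers (u @ v)) = rook_number k (ferrers (u @ w))"
  using assms(1,2)
proof (induction u arbitrary: k)
  case (Cons m u)
  have p: "is_partition (m # (u @ v))" "is_partition (m # (u @ w))"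
    using Cons.prems by simp_all
  have IH: "rook_number k (ferrers (u @ v)) = rook_number k (ferrers (u @ w))" for k
    using p by (intro Cons.IH) (simp_all add: is_partition_Cons)
  show ?case
    by (cases k) (simp_all add: rook_number_Cons[OF p(1)] rook_number_Cons[OF p(2)] IH)
qed (simp add: assms(3))

lemma i1_step_rook_equivalent:
  assumes "i1_step \<mu> \<nu>" "is_partition \<mu>"
  shows "rook_equivalent \<mu> \<nu>"
proof -
  obtain u v where v: "v \<noteq> []" and eq: "\<mu> = u @ v" "\<nu> = u @ conjugate v" and \<nu>: "is_partition \<nu>"
    using assms by (auto simp: i1_step_iff)
  have p: "is_partition v" using assms(2) by (simp add: eq is_partition_append)
  have "rook_number k (ferrers v) = rook_number k (ferrers (conjugate v))" for k
    unfolding ferrers_conjugate[OF p]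
    by (rule rook_number_image[symmetric]) auto
  then show ?thesis
    using rook_number_append_cong[of u v "conjugate v"] assms(2) \<nu>
    by (auto simp: rook_equivalent_iff eq)
qed

lemma i1_steps_rook_equivalent:
  "i1_step\<^sup>*\<^sup>* \<mu> \<nu> \<Longrightarrow> is_partition \<mu> \<Longrightarrow> rook_equivalent \<mu> \<nu>"
proof (induction rule: rtranclp_induct)
  case (step \<nu> \<rho>)
  then have "rook_equivalent \<nu> \<rho>"
    using i1_step_rook_equivalent i1_steps_is_partition by blast
  then show ?case using step by (simp add: rook_equivalent_def)
qed (simp add: rook_equivalent_def)

text \<open>A single rook may stand on any box. Hence rook equivalence preserves the size of a
  partition.\<close>

lemma rook_number_1: "is_partition \<mu> \<Longrightarrow> rook_number (Suc 0) (ferrers \<mu>) = sum_list \<mu>"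
  by (induction \<mu>) (auto simp: rook_number_Cons is_partition_Cons)

section \<open>Reaching a partition with distinct parts\<close>

text \<open>Either some tail has more rows than columns, and conjugating the largest such tail
  lengthens its first row; or there is none, and two conjugations lengthen the first of two equal
  parts. The rows above stay, so the result is lexicographically greater.\<close>

lemma exists_greater_reachable:
  assumes p: "is_partition \<mu>" and "\<not> sorted_wrt (>) \<mu>"
  shows "\<exists>\<nu>. i1_step\<^sup>*\<^sup>* \<mu> \<nu> \<and> \<mu> < \<nu>"
proof -
  have less: "u @ x # v < u @ w" if "w \<noteq> []" "x < hd w" for u v w :: "nat list" and x
    using that by (cases w) (auto simp: list_less_def lexord_append_leftI)
  let ?l = "length \<mu>"
  have decomp: "\<mu> = take i \<mu> @ \<mu> ! i # drop (Suc i) \<mu>" if "i < ?l" for i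
    using that by (simp add: id_take_nth_drop[symmetric])
  have in_take: "\<exists>j<i. x = \<mu> ! j" if "x \<in> set (take i \<mu>)" for x i
    using that by (auto simp: in_set_conv_nth)
  show ?thesis
  proof (cases "\<exists>i<?l. \<mu> ! i < ?l - i")
    case True
    \<comment> \<open>The largest tail with more rows than columns is replaced by its conjugate.\<close>
    then obtain i where i: "i < ?l" "\<mu> ! i < ?l - i"
      and least: "\<And>j. j < i \<Longrightarrow> \<not> (j < ?l \<and> \<mu> ! j < ?l - j)"
      using exists_least_iff[of "\<lambda>i. i < ?l \<and> \<mu> ! i < ?l - i"] by blast
    define u v where "u = take i \<mu>" and "v = \<mu> ! i # drop (Suc i) \<mu>"
    have \<mu>: "\<mu> = u @ v" using decomp[OF i(1)] by (simp add: u_def v_def)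
    have len: "length v = ?l - i" using i by (simp add: v_def)
    \<comment> \<open>For \<open>j < i\<close>, minimality of \<open>i\<close> gives
      \<open>\<mu> ! j \<ge> ?l - j > ?l - i\<close>.\<close>
    have "length v \<le> x" if "x \<in> set u" for x
    proof -
      obtain j where "j < i" "x = \<mu> ! j" using \<open>x \<in> set u\<close> in_take by (auto simp: u_def)
      then show ?thesis using least[of j] i(1) len by auto
    qed
    moreover have v: "v \<noteq> []" by (simp add: v_def)
    ultimately have step: "i1_step \<mu> (u @ conjugate v)"
      using i1_step_append_conjugate p \<mu> by metis
    have pv: "is_partition v" using p by (simp add: \<mu> is_partition_append)
    have "\<mu> ! i < hd (conjugate v)"
      using i len hd_conjugate[OF pv v] by simp
    then have "\<mu> < u @ conjugate v"
      using less[OF conjugate_not_Nil[OF pv v], of "\<mu> ! i" u "drop (Suc i) \<mu>"]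
        decomp[OF i(1)] by (simp add: u_def[symmetric])
    then show ?thesis using step by blast
  next
    case False
    have "\<exists>i. Suc i < ?l \<and> \<not> \<mu> ! Suc i < \<mu> ! i"
      using assms(2) sorted_wrt_iff_nth_Suc_transp[of "(>)" \<mu>] by (auto simp: transp_def)
    then obtain i where i: "Suc i < ?l" "\<not> \<mu> ! Suc i < \<mu> ! i"
      and least: "\<And>j. j < i \<Longrightarrow> \<not> (Suc j < ?l \<and> \<not> \<mu> ! Suc j < \<mu> ! j)"
      using exists_least_iff[of "\<lambda>i. Suc i < ?l \<and> \<not> \<mu> ! Suc i < \<mu> ! i"] by blast
    have mono: "\<mu> ! b \<le> \<mu> ! a" if "a \<le> b" "b < ?l" for a b
      using p that by (cases "a = b") (auto simp: is_partition_def sorted_wrt_iff_nth_less)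
    define u x v where "u = take i \<mu>" and "x = \<mu> ! i" and "v = drop (Suc i) \<mu>"
    have \<mu>: "\<mu> = u @ x # v" using decomp[of i] i by (simp add: u_def v_def x_def)
    have v: "v \<noteq> []" using i by (simp add: v_def)
    \<comment> \<open>Weak decrease turns the failed strict inequality into equality.\<close>
    have hdv: "hd v = x"
      using i mono[of i "Suc i"] by (simp add: v_def x_def hd_drop_conv_nth)
    have pv: "is_partition v" using p by (simp add: \<mu> is_partition_append is_partition_Cons)
    \<comment> \<open>The tail starting with \<open>x\<close> is at least as wide as it is tall, and
      it has one row more than \<open>v\<close>.\<close>
    have "?l - i \<le> x" unfolding x_def using False Suc_lessD[OF i(1)] not_less by blast
    then have lenv: "length v < x" using i(1) by (simp add: v_def)
    \<comment> \<open>By minimality of \<open>i\<close> the parts strictly decrease down to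
      \<open>x\<close>, which leaves room below \<open>u\<close> for a row of length
      \<open>x + 1\<close>.\<close>
    have u_big: "x < y" if "y \<in> set u" for y
    proof -
      obtain j where j: "j < i" "y = \<mu> ! j"
        using \<open>y \<in> set u\<close> in_take by (auto simp: u_def)
      then have "\<mu> ! Suc j < \<mu> ! j" using least[of j] i by auto
      then show ?thesis using mono[of "Suc j" i] i j by (auto simp: x_def)
    qed
    \<comment> \<open>Conjugating \<open>v\<close> and then \<open>x # conjugate v\<close> appends to \<open>v\<close> a column of length \<open>x\<close>,
      which turns the topmost repeated part \<open>x\<close> into \<open>x + 1\<close>.\<close>
    have step1: "i1_step \<mu> (u @ x # conjugate v)"
      using i1_step_append_conjugate[of "u @ [x]" v] p v lenv u_big by (force simp: \<mu>)
    let ?w = "x # conjugate v"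
    have p1: "is_partition (u @ ?w)" using step1 by (rule i1_step_is_partition)
    then have pw: "is_partition ?w" by (simp add: is_partition_append)
    have step2: "i1_step (u @ ?w) (u @ conjugate ?w)"
      using i1_step_append_conjugate[OF p1] u_big by (simp add: hdv Suc_le_eq)
    \<comment> \<open>\<open>conjugate v\<close> has \<open>hd v = x\<close> parts, so
      \<open>?w\<close> has \<open>x + 1\<close> rows.\<close>
    have "x < hd (conjugate ?w)"
      using hd_conjugate[OF pw] by (simp add: hdv)
    then have "\<mu> < u @ conjugate ?w"
      unfolding \<mu> using conjugate_not_Nil[OF pw] by (intro less) auto
    then show ?thesis
      using step1 step2 by (meson converse_rtranclp_into_rtranclp rtranclp.rtrancl_refl)
  qed
qed

lemma partition_length_le_sum: "is_partition \<mu> \<Longrightarrow> length \<mu> \<le> sum_list \<mu>"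
  by (induction \<mu>) (auto simp: is_partition_Cons)

text \<open>All reachable partitions have the size of \<open>\<mu>\<close>, so they are finitely
  many. If their lexicographic maximum had a repeated part, a greater partition would be
  reachable.\<close>

lemma reaches_distinct_partition:
  assumes p: "is_partition \<mu>"
  shows "\<exists>\<nu>. i1_step\<^sup>*\<^sup>* \<mu> \<nu> \<and> sorted_wrt (>) \<nu>"
proof -
  let ?R = "{\<nu>. i1_step\<^sup>*\<^sup>* \<mu> \<nu>}"
  let ?n = "sum_list \<mu>"
  have "?R \<subseteq> {xs. set xs \<subseteq> {..?n} \<and> length xs \<le> ?n}"
  proof
    fix \<nu> assume "\<nu> \<in> ?R"
    then have q: "is_partition \<nu>" and "rook_equivalent \<mu> \<nu>"
      using p i1_steps_is_partition i1_steps_rook_equivalent by auto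
    then have "sum_list \<nu> = ?n"
      using p rook_number_1 by (metis rook_equivalent_iff)
    then show "\<nu> \<in> {xs. set xs \<subseteq> {..?n} \<and> length xs \<le> ?n}"
      using partition_length_le_sum[OF q] member_le_sum_list[of _ \<nu>] by auto
  qed
  then have fin: "finite ?R"
    using finite_lists_length_le[of "{..?n}" ?n] finite_subset by blast
  moreover have "?R \<noteq> {}" by auto
  ultimately have max: "Max ?R \<in> ?R" by (rule Max_in)
  have "sorted_wrt (>) (Max ?R)"
  proof (rule ccontr)
    assume "\<not> sorted_wrt (>) (Max ?R)"
    then obtain \<nu> where "i1_step\<^sup>*\<^sup>* (Max ?R) \<nu>" "Max ?R < \<nu>"
      using exists_greater_reachable max p i1_steps_is_partition by blast
    moreover then have "\<nu> \<in> ?R" using max by (auto intro: rtranclp_trans)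
    ultimately show False using Max_ge[OF fin] by (auto simp: not_le[symmetric])
  qed
  then show ?thesis using max by blast
qed

section \<open>The rook numbers determine a partition with distinct parts\<close>

text \<open>Constants \<open>c\<close> of the linear factors \<open>x + c\<close> in the
  Goldman-Joichi-White factorization. The shift counts the rows below, so a new top row leaves the
  other constants unchanged.\<close>

fun shifted_parts :: "nat list \<Rightarrow> int list" where
  "shifted_parts [] = []"
| "shifted_parts (m # \<mu>) = (int m - int (length \<mu>)) # shifted_parts \<mu>"

lemma length_shifted_parts [simp]: "length (shifted_parts \<mu>) = length \<mu>"
  by (induction \<mu>) auto

lemma shifted_parts_inject: "shifted_parts \<mu> = shifted_parts \<nu> \<Longrightarrow> \<mu> = \<nu>"
proof (induction \<mu> arbitrary: \<nu>)
  case Nil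
  then show ?case by (cases \<nu>) auto
next
  case (Cons m \<mu>)
  then obtain m' \<nu>' where \<nu>: "\<nu> = m' # \<nu>'" by (cases \<nu>) auto
  then have "\<mu> = \<nu>'" using Cons.prems by (intro Cons.IH) simp
  then show ?case using Cons.prems \<nu> by simp
qed

text \<open>Distinct parts drop by at least one from a row to the next, while the subtracted number
  of rows below drops by exactly one.\<close>

lemma sorted_shifted_parts: "sorted_wrt (>) \<mu> \<Longrightarrow> sorted_wrt (\<ge>) (shifted_parts \<mu>)"
proof (induction \<mu> rule: shifted_parts.induct)
  case (2 m \<mu>)
  then show ?case
    by (cases \<mu>) (auto intro: order_trans)
qed simp

text \<open>More rooks than rows or than columns do not fit. For the empty partition the bound on
  the parts is vacuous, and \<open>0 < k\<close> excludes the empty placement.\<close>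

lemma rook_number_eq_0:
  "is_partition \<mu> \<Longrightarrow> length \<mu> < k \<or> (\<forall>x\<in>set \<mu>. x < k) \<and> 0 < k \<Longrightarrow> rook_number k (ferrers \<mu>) = 0"
proof (induction \<mu> arbitrary: k)
  case Nil
  then show ?case by (cases k) auto
next
  case (Cons m \<mu>)
  then obtain k' where k: "k = Suc k'" by (cases k) auto
  have p: "is_partition \<mu>" using Cons.prems by (simp add: is_partition_Cons)
  have "rook_number k (ferrers \<mu>) = 0"
    using Cons.prems by (intro Cons.IH p) auto
  moreover have "m \<le> k' \<or> rook_number k' (ferrers \<mu>) = 0"
    using Cons.prems k by (cases "m \<le> k'") (auto intro!: Cons.IH p)
  ultimately show ?case
    using rook_number_Cons[OF Cons.prems(1), of k'] k by auto
qed

text \<open>Each part exceeds the number of rows below it, since these have distinct positive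
  lengths smaller than it. Hence every row can receive a rook.\<close>

lemma rook_number_length_distinct:
  "is_partition \<mu> \<Longrightarrow> sorted_wrt (>) \<mu> \<Longrightarrow> rook_number (length \<mu>) (ferrers \<mu>) \<noteq> 0"
proof (induction \<mu>)
  case (Cons m \<mu>)
  have "distinct \<mu>" using Cons.prems(2) by (induction \<mu>) auto
  moreover have "set \<mu> \<subseteq> {1..<m}"
    using Cons.prems by (auto simp: is_partition_def Suc_le_eq intro: gr0I)
  ultimately have "length \<mu> \<le> m - 1"
    using card_mono[of "{1..<m}" "set \<mu>"] by (simp add: distinct_card)
  then have "length \<mu> < m" using Cons.prems(1) by (auto simp: is_partition_Cons)
  then show ?case
    using Cons rook_number_Cons[OF Cons.prems(1), of "length \<mu>"] by (simp add: is_partition_Cons)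
qed simp

text \<open>With \<open>l\<close> rows below a new top row \<open>m\<close>, the recurrence gives
  the \<open>k\<close>-th term the weights \<open>x - (l - k)\<close> and \<open>m - k\<close>.
  Their sum \<open>x + m - l\<close> does not depend on \<open>k\<close> and factors out.\<close>

lemma rook_factorization:
  fixes x :: int
  assumes "is_partition \<mu>"
  shows "(\<Sum>k\<le>length \<mu>. int (rook_number k (ferrers \<mu>)) * (\<Prod>i<length \<mu> - k. x - int i)) =
    prod_list (map (\<lambda>c. x + c) (shifted_parts \<mu>))"
  using assms
proof (induction \<mu>)
  case (Cons m \<mu>)
  let ?l = "length \<mu>"
  let ?r = "\<lambda>k. int (rook_number k (ferrers \<mu>))"
  let ?F = "\<lambda>n. \<Prod>i<n. x - int i"
  have p: "is_partition \<mu>" using Cons.prems by (simp add: is_partition_Cons)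
  \<comment> \<open>For \<open>k > m\<close> the integer \<open>int m - int k\<close> is negative
    where the truncated difference is 0, but then \<open>?r k\<close> vanishes because all rows are
    shorter than \<open>k\<close>.\<close>
  have rec: "int (rook_number (Suc k) (ferrers (m # \<mu>))) = ?r (Suc k) + (int m - int k) * ?r k" for k
  proof (cases "k \<le> m")
    case False
    then have "?r k = 0"
      using Cons.prems by (simp, intro rook_number_eq_0[OF p]) (fastforce simp: is_partition_Cons)
    then show ?thesis using False rook_number_Cons[OF Cons.prems, of k] by simp
  qed (simp add: rook_number_Cons[OF Cons.prems])
  have "(\<Sum>k\<le>Suc ?l. int (rook_number k (ferrers (m # \<mu>))) * ?F (Suc ?l - k)) =
      ?F (Suc ?l) + (\<Sum>k\<le>?l. (?r (Suc k) + (int m - int k) * ?r k) * ?F (?l - k))"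
    by (simp add: sum.atMost_Suc_shift rec del: sum.atMost_Suc prod.lessThan_Suc)
  also have "\<dots> = (\<Sum>k\<le>Suc ?l. ?r k * ?F (Suc ?l - k)) + (\<Sum>k\<le>?l. (int m - int k) * ?r k * ?F (?l - k))"
    by (simp add: sum.atMost_Suc_shift sum.distrib distrib_right del: sum.atMost_Suc prod.lessThan_Suc)
  \<comment> \<open>\<open>?l + 1\<close> rooks do not fit into \<open>?l\<close> rows.\<close>
  also have "(\<Sum>k\<le>Suc ?l. ?r k * ?F (Suc ?l - k)) = (\<Sum>k\<le>?l. ?r k * ?F (Suc ?l - k))"
    using rook_number_eq_0[OF p, of "Suc ?l"] by simp
  also have "\<dots> = (\<Sum>k\<le>?l. (x - int (?l - k)) * ?r k * ?F (?l - k))"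
    by (intro sum.cong) (simp_all add: Suc_diff_le mult_ac)
  also have "\<dots> + (\<Sum>k\<le>?l. (int m - int k) * ?r k * ?F (?l - k)) =
      (\<Sum>k\<le>?l. (x + (int m - int ?l)) * (?r k * ?F (?l - k)))"
    unfolding sum.distrib[symmetric]
    by (intro sum.cong) (auto simp: of_nat_diff algebra_simps)
  also have "\<dots> = (x + (int m - int ?l)) * (\<Sum>k\<le>?l. ?r k * ?F (?l - k))"
    by (rule sum_distrib_left[symmetric])
  finally show ?case using Cons.IH[OF p] by simp
qed simp

lemma poly_prod_linear_factors:
  fixes x :: int
  shows "poly (prod_list (map (\<lambda>c. [:c, 1:]) cs)) x = prod_list (map (\<lambda>c. x + c) cs)"
  by (induction cs) (auto simp: algebra_simps)

text \<open>The root \<open>- c\<close> of the left side is a root of the right side, so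
  \<open>c\<close> occurs in \<open>ds\<close> and the common factor cancels. \<open>remove1\<close>
  takes away a single copy, which keeps track of multiplicities.\<close>

lemma mset_eq_of_linear_factors:
  assumes "prod_list (map (\<lambda>c. [:c, 1:]) cs) = prod_list (map (\<lambda>c. [:c, 1:]) (ds :: int list))"
  shows "mset cs = mset ds"
  using assms
proof (induction cs arbitrary: ds)
  case Nil
  show ?case
  proof (cases ds)
    case (Cons d ds')
    then have "poly (prod_list (map (\<lambda>c. [:c, 1:]) ds)) (- d) = 0" by simp
    then show ?thesis by (simp flip: Nil)
  qed simp
next
  case (Cons c cs)
  have "poly (prod_list (map (\<lambda>c. [:c, 1:]) (c # cs))) (- c) = 0" by simp
  then have "prod_list (map (\<lambda>d. - c + d) ds) = 0"
    unfolding Cons.prems poly_prod_linear_factors .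
  then have c: "c \<in> set ds" by (auto simp: prod_list_zero_iff)
  then have "prod_list (map (\<lambda>c. [:c, 1:]) ds) =
      [:c, 1:] * prod_list (map (\<lambda>c. [:c, 1:]) (remove1 c ds))"
    by (induction ds) (auto simp del: mult_pCons_left mult_pCons_right simp: mult.left_commute)
  then have "[:c, 1:] * prod_list (map (\<lambda>c. [:c, 1:]) cs) =
      [:c, 1:] * prod_list (map (\<lambda>c. [:c, 1:]) (remove1 c ds))"
    using Cons.prems by simp
  then have "mset cs = mset (remove1 c ds)"
    by (intro Cons.IH) (simp del: mult_pCons_left)
  then show ?case using c by simp
qed

lemma rook_equivalent_distinct_eq:
  assumes \<mu>: "is_partition \<mu>" "sorted_wrt (>) \<mu>" and \<nu>: "is_partition \<nu>" "sorted_wrt (>) \<nu>"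
    and eq: "rook_equivalent \<mu> \<nu>"
  shows "\<mu> = \<nu>"
proof -
  have r: "rook_number k (ferrers \<mu>) = rook_number k (ferrers \<nu>)" for k
    using eq by (simp add: rook_equivalent_iff)
  \<comment> \<open>For distinct parts, the number of rows is the largest \<open>k\<close> with a
    nonzero rook number.\<close>
  have len: "length \<mu> = length \<nu>"
    using rook_number_length_distinct[OF \<mu>] rook_number_length_distinct[OF \<nu>]
      rook_number_eq_0[OF \<mu>(1), of "length \<nu>"] rook_number_eq_0[OF \<nu>(1), of "length \<mu>"] r
    by (metis nat_neq_iff)
  \<comment> \<open>Both products take the same value at every integer, hence agree as
    polynomials.\<close>
  have "prod_list (map (\<lambda>c. [:c, 1:]) (shifted_parts \<mu>)) =
      prod_list (map (\<lambda>c. [:c, 1:]) (shifted_parts \<nu>))"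
    using rook_factorization[OF \<mu>(1)] rook_factorization[OF \<nu>(1)] r len
    by (simp add: poly_eq_poly_eq_iff[symmetric] fun_eq_iff poly_prod_linear_factors)
  then have "mset (shifted_parts \<mu>) = mset (shifted_parts \<nu>)"
    by (rule mset_eq_of_linear_factors)
  \<comment> \<open>The lists are weakly decreasing; reversal makes them ascending, and an ascending
    list is determined by its multiset.\<close>
  then have "mset (rev (shifted_parts \<mu>)) = mset (rev (shifted_parts \<nu>))" by simp
  then have "rev (shifted_parts \<mu>) = rev (shifted_parts \<nu>)"
    using sorted_shifted_parts[OF \<mu>(2)] sorted_shifted_parts[OF \<nu>(2)]
    by (metis properties_for_sort sorted_wrt_rev)
  then show ?thesis by (simp add: shifted_parts_inject)
qed

theorem theorem10:
  fixes n :: nat and \<mu> \<nu> :: "nat list"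
  assumes "is_partition_of n \<mu>" and "is_partition_of n \<nu>"
  shows "rook_equivalent \<mu> \<nu> \<longleftrightarrow> i1_equivalent \<mu> \<nu>"
proof -
  have p: "is_partition \<mu>" "is_partition \<nu>"
    using assms by (simp_all add: is_partition_of_def)
  show ?thesis
  proof
    assume eq: "rook_equivalent \<mu> \<nu>"
    obtain \<sigma> where \<sigma>: "i1_step\<^sup>*\<^sup>* \<mu> \<sigma>" "sorted_wrt (>) \<sigma>"
      using reaches_distinct_partition[OF p(1)] by blast
    obtain \<tau> where \<tau>: "i1_step\<^sup>*\<^sup>* \<nu> \<tau>" "sorted_wrt (>) \<tau>"
      using reaches_distinct_partition[OF p(2)] by blast
    have "rook_equivalent \<sigma> \<tau>"
      using eq i1_steps_rook_equivalent[OF \<sigma>(1) p(1)] i1_steps_rook_equivalent[OF \<tau>(1) p(2)]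
      by (simp add: rook_equivalent_def)
    then have "\<sigma> = \<tau>"
      using rook_equivalent_distinct_eq \<sigma> \<tau> p i1_steps_is_partition by blast
    \<comment> \<open>The path from \<open>\<nu>\<close> to the common partition with distinct parts
      is traversed backwards.\<close>
    then have "i1_step\<^sup>*\<^sup>* \<mu> \<nu>"
      using \<sigma>(1) i1_steps_sym[OF \<tau>(1) p(2)] by simp
    then show "i1_equivalent \<mu> \<nu>" by (simp add: i1_equivalent_def)
  next
    assume "i1_equivalent \<mu> \<nu>"
    then show "rook_equivalent \<mu> \<nu>"
      using i1_steps_rook_equivalent p by (auto simp: i1_equivalent_def rook_equivalent_def)
  qed
qed

end
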